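(* Let $j \in \mathbb{N}$ and let $n \in \mathbb{O}_+$ have reduced Collatz sequence $$n\xrightarrow{a_1}C(n)\xrightarrow{a_2}\cdots\xrightarrow{a_{j-1}}C^{j-1}(n)\xrightarrow{a_j}1$$ of length $j$. Let $b \in \mathbb{N}_0$, set $a_{j+1} = 2b\cdot 3^j + 2$, and let $$m = \frac{2^{a_1+a_2+\cdots+a_j}}{3^{j+1}}\left(2^{a_{j+1}}-2^2\right)+n.$$ Then $m$ is a positive odd integer with reduced Collatz sequence $$m\xrightarrow{a_1}C(m)\xrightarrow{a_2}\cdots\xrightarrow{a_j}C^{j}(m)\xrightarrow{a_{j+1}}1$$ of length $j+1$.
   Context: $\mathbb{N}$ denotes the positive integers, $\mathbb{N}_0=\mathbb{N}\cup\{0\}$, and $\mathbb{O}_+$ the set of positive odd integers. The reduced Collatz function $C : \mathbb{O}_+ \to \mathbb{O}_+$ is $C(n) = \frac{3n+1}{2^a}$, where $a \in \mathbb{N}$ is the largest exponent such that $2^a \mid 3n+1$; $C^i$ is its $i$-th iterate. The notation $n \xrightarrow{a_1} C(n) \xrightarrow{a_2} \cdots \xrightarrow{a_j} C^j(n)$ means that for each $1\le i\le j$, $a_i$ is the largest exponent with $2^{a_i} \mid 3C^{i-1}(n)+1$, so that $C^i(n) = (3C^{i-1}(n)+1)/2^{a_i}$ (with $C^0(n)=n$). One says $n$ has reduced Collatz sequence length $j$ if $C^j(n)=1$; it is not required that $j$ be the first index at which $1$ is reached (so $1 \xrightarrow{2} 1$ may be repeated). *)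

theory Defs
  imports Complex_Main "HOL-Computational_Algebra.Primes"
begin

(* The functions below are total on nat; the Collatz function is only meant to be
   applied to odd (hence positive) arguments. *)

definition collatz_exponent :: "nat \<Rightarrow> nat" where
  "collatz_exponent n = multiplicity (2 :: nat) (3 * n + 1)"

(* The division is exact, by the choice of the exponent. *)
definition collatz :: "nat \<Rightarrow> nat" where
  "collatz n = (3 * n + 1) div 2 ^ collatz_exponent n"

(* n --a 1--> C(n) --a 2--> ... --a j--> C^j(n).  Only the values a 1, ..., a j matter. *)
definition collatz_arrows :: "nat \<Rightarrow> (nat \<Rightarrow> nat) \<Rightarrow> nat \<Rightarrow> bool" where
  "collatz_arrows n a j \<longleftrightarrow> (\<forall>i\<in>{1..j}. a i = collatz_exponent ((collatz ^^ (i - 1)) n))"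

(* j need not be the first index at which 1 is reached. *)
definition reduced_collatz_sequence :: "nat \<Rightarrow> (nat \<Rightarrow> nat) \<Rightarrow> nat \<Rightarrow> bool" where
  "reduced_collatz_sequence n a j \<longleftrightarrow> collatz_arrows n a j \<and> (collatz ^^ j) n = 1"

end

theory Submission
  imports Defs
begin

text \<open>Adding a multiple of \<open>2 ^ (e + 1)\<close> to \<open>x\<close>, where \<open>e\<close> is the exponent of \<open>x\<close>, changes
  neither that exponent nor the parity of the image, so adding a multiple of
  \<open>2 ^ (a\<^sub>1 + \<dots> + a\<^sub>j + 1)\<close> to \<open>n\<close> preserves the first \<open>j\<close> exponents, and each step multiplies the
  perturbation by \<open>3\<close> and divides it by \<open>2 ^ a\<^sub>i\<close>. As \<open>3 ^ (j + 1)\<close> divides \<open>4 ^ (b * 3 ^ j) - 1\<close>, say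
  with quotient \<open>K\<close>, this applies to \<open>m = n + 2 ^ (a\<^sub>1 + \<dots> + a\<^sub>j + 2) * K\<close> and gives
  \<open>C\<^sup>j(m) = 1 + 4 * 3 ^ j * K\<close>, whence \<open>3 * C\<^sup>j(m) + 1 = 4 ^ (b * 3 ^ j + 1)\<close> is a power of \<open>2\<close>.\<close>

lemma collatz_eqI:
  assumes "3 * x + 1 = 2 ^ e * y" and "odd y"
  shows "collatz_exponent x = e" and "collatz x = y"
proof -
  show e: "collatz_exponent x = e"
    unfolding collatz_exponent_def
    by (rule multiplicity_eqI) (use assms in auto)
  show "collatz x = y"
    unfolding collatz_def e assms(1) by simp
qed

lemma collatz_mult: "3 * x + 1 = 2 ^ collatz_exponent x * collatz x"
  unfolding collatz_def collatz_exponent_def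
  by (simp add: multiplicity_dvd)

lemma odd_collatz: "odd (collatz x)"
  using multiplicity_decompose[of "3 * x + 1" "2::nat"]
  unfolding collatz_def collatz_exponent_def by simp

text \<open>With \<open>e\<close> the exponent of \<open>x\<close>,
  \<open>3 * y + 1 = 2 ^ e * (collatz x + 2 * (3 * t))\<close>. The extra factor \<open>2\<close> in
  the shift keeps the cofactor odd.\<close>

lemma collatz_shift:
  fixes x t :: nat
  defines "y \<equiv> x + 2 ^ (collatz_exponent x + 1) * t"
  shows "collatz_exponent y = collatz_exponent x" and "collatz y = collatz x + 2 * (3 * t)"
proof -
  have "3 * y + 1 = (3 * x + 1) + 2 ^ collatz_exponent x * (2 * (3 * t))"
    by (simp add: y_def)
  also have "\<dots> = 2 ^ collatz_exponent x * (collatz x + 2 * (3 * t))"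
    by (simp only: collatz_mult[of x] distrib_left)
  finally have *: "3 * y + 1 = 2 ^ collatz_exponent x * (collatz x + 2 * (3 * t))" .
  have "odd (collatz x + 2 * (3 * t))"
    using odd_collatz[of x] by simp
  from collatz_eqI[OF * this]
  show "collatz_exponent y = collatz_exponent x" and "collatz y = collatz x + 2 * (3 * t)" .
qed

lemma collatz_arrows_Suc:
  "collatz_arrows n a (Suc j) \<longleftrightarrow>
    collatz_arrows n a j \<and> a (Suc j) = collatz_exponent ((collatz ^^ j) n)"
  unfolding collatz_arrows_def by (auto simp: atLeastAtMostSuc_conv)

lemma collatz_arrows_shift:
  assumes "collatz_arrows n a j"
  shows "collatz_arrows (n + 2 ^ ((\<Sum>i = 1..j. a i) + 1) * t) a j \<and>
    (collatz ^^ j) (n + 2 ^ ((\<Sum>i = 1..j. a i) + 1) * t) = (collatz ^^ j) n + 2 * (3 ^ j * t)"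
  using assms
proof (induction j arbitrary: t)
  case 0
  then show ?case by (simp add: collatz_arrows_def)
next
  case (Suc j)
  define x where "x = (collatz ^^ j) n"
  define N where "N = n + 2 ^ ((\<Sum>i = 1..Suc j. a i) + 1) * t"
  have arr: "collatz_arrows n a j" and aj: "a (Suc j) = collatz_exponent x"
    using Suc.prems by (simp_all add: collatz_arrows_Suc x_def)
  \<comment> \<open>The last exponent moves into the multiplier, hence \<open>t\<close> is arbitrary
    in the induction. After \<open>j\<close> steps exactly this power of \<open>2\<close> is left
    for \<open>collatz_shift\<close>.\<close>
  have N: "N = n + 2 ^ ((\<Sum>i = 1..j. a i) + 1) * (2 ^ a (Suc j) * t)"
    by (simp add: N_def power_add mult_ac)
  have "collatz_arrows N a j" and "(collatz ^^ j) N = x + 2 ^ (collatz_exponent x + 1) * (3 ^ j * t)"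
    using Suc.IH[OF arr, of "2 ^ a (Suc j) * t"] by (simp_all add: N x_def aj mult_ac)
  then show ?case
    unfolding N_def[symmetric]
    using collatz_shift[of x "3 ^ j * t"] aj
    by (simp add: collatz_arrows_Suc x_def mult_ac)
qed

text \<open>Each cubing gains a factor \<open>3\<close>: in
  \<open>z ^ 3 - 1 = (z - 1) * (z ^ 2 + z + 1)\<close> the second factor is divisible by
  \<open>3\<close> when \<open>z\<close> is 1 modulo \<open>3\<close>.\<close>

lemma power3_dvd_power_power3_minus_1:
  fixes y :: int
  assumes "3 dvd y - 1"
  shows "3 ^ (j + 1) dvd y ^ (3 ^ j) - 1"
proof (induction j)
  case 0
  then show ?case using assms by simp
next
  case (Suc j)
  define z where "z = y ^ (3 ^ j)"
  have "3 dvd z - 1"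
    using Suc.IH dvd_trans[of 3 "3 ^ (j + 1)" "z - 1"] by (simp add: z_def)
  then have "3 dvd (z - 1) * (z + 2) + 3"
    by simp
  also have "(z - 1) * (z + 2) + 3 = z ^ 2 + z + 1"
    by (simp add: algebra_simps power2_eq_square)
  finally have "3 ^ (j + 1) * 3 dvd (z - 1) * (z ^ 2 + z + 1)"
    using Suc.IH by (intro mult_dvd_mono) (simp_all add: z_def)
  also have "(z - 1) * (z ^ 2 + z + 1) = z ^ 3 - 1"
    by (simp add: algebra_simps power2_eq_square power3_eq_cube)
  also have "z ^ 3 = y ^ (3 ^ Suc j)"
    by (simp add: z_def power_mult[symmetric] mult.commute)
  finally show ?case by (simp add: mult.commute)
qed

lemma power3_quotient_of_power4:
  obtains K :: nat where "4 ^ (b * 3 ^ j) = 1 + 3 ^ (j + 1) * K"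
proof -
  have "(4 - 1 :: int) dvd 4 ^ b - 1 ^ b"
    by (subst power_diff_sumr2) simp
  then have "(3 :: int) dvd 4 ^ b - 1"
    by simp
  then have "(3 :: int) ^ (j + 1) dvd (4 ^ b) ^ (3 ^ j) - 1"
    by (rule power3_dvd_power_power3_minus_1)
  then have "int (3 ^ (j + 1)) dvd int (4 ^ (b * 3 ^ j) - 1)"
    by (simp add: power_mult of_nat_diff)
  then have "3 ^ (j + 1) dvd (4 ^ (b * 3 ^ j) - 1 :: nat)"
    by (simp only: int_dvd_int_iff)
  then obtain K where "(4 ^ (b * 3 ^ j) - 1 :: nat) = 3 ^ (j + 1) * K" ..
  moreover have "(1 :: nat) \<le> 4 ^ (b * 3 ^ j)"
    by simp
  ultimately have "4 ^ (b * 3 ^ j) = 1 + 3 ^ (j + 1) * K"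
    by linarith
  then show thesis ..
qed

theorem theorem3p1:
  fixes j n b :: nat and a :: "nat \<Rightarrow> nat" and m :: rat
  assumes "j \<ge> 1"
    and "n > 0" and "odd n"
    and "reduced_collatz_sequence n a j"
    and "a (j + 1) = 2 * b * 3 ^ j + 2"
    and "m = 2 ^ (\<Sum>i = 1..j. a i) / 3 ^ (j + 1) * (2 ^ a (j + 1) - 2 ^ 2) + of_nat n"
  shows "\<exists>M :: nat. m = of_nat M \<and> M > 0 \<and> odd M \<and> reduced_collatz_sequence M a (j + 1)"
proof -
  obtain K :: nat where K: "4 ^ (b * 3 ^ j) = 1 + 3 ^ (j + 1) * K"
    by (rule power3_quotient_of_power4)
  have "2 ^ a (j + 1) = (4 * 4 ^ (b * 3 ^ j) :: nat)"
    using power_mult[of "2 :: nat" 2 "b * 3 ^ j"] unfolding assms(5) by (simp add: mult_ac)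
  then have pow: "2 ^ a (j + 1) = (4 + 4 * 3 ^ (j + 1) * K :: nat)"
    by (simp add: K)
  define s where "s = (\<Sum>i = 1..j. a i)"
  \<comment> \<open>Since \<open>2 ^ a (j + 1) - 4 = 4 * 3 ^ (j + 1) * K\<close>, the denominator of
    \<open>m\<close> cancels. One factor \<open>2\<close> stays with \<open>K\<close>, to match the
    shift lemma with \<open>t = 2 * K\<close>.\<close>
  define M where "M = n + 2 ^ (s + 1) * (2 * K)"
  have "(2 :: rat) ^ a (j + 1) = of_nat (2 ^ a (j + 1))"
    by simp
  also have "\<dots> = 4 + 4 * 3 ^ (j + 1) * of_nat K"
    unfolding pow by simp
  finally have "m = of_nat M"
    by (simp add: assms(6) M_def s_def)
  moreover have "M > 0" and "odd M"
    using assms(2,3) by (simp_all add: M_def)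
  moreover have "reduced_collatz_sequence M a (j + 1)"
  proof -
    have arr: "collatz_arrows M a j" and CjM: "(collatz ^^ j) M = 1 + 2 * (3 ^ j * (2 * K))"
      using assms(4) collatz_arrows_shift[of n a j "2 * K"]
      by (simp_all add: reduced_collatz_sequence_def M_def s_def)
    \<comment> \<open>The cofactor \<open>1\<close> is odd, so this one equation yields both the
      last exponent and the final value \<open>1\<close>.\<close>
    have "3 * (collatz ^^ j) M + 1 = 2 ^ a (j + 1) * 1"
      by (simp add: CjM pow[simplified])
    from collatz_eqI[OF this] show ?thesis
      using arr by (simp add: reduced_collatz_sequence_def collatz_arrows_Suc)
  qed
  ultimately show ?thesis by blast
qed

end
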